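(* Let $(G,r)$ be a connected locally finite network, and let $S$ be a set of edges of $G$ such that $G-S$ is connected and $\sum_{e\in S}1/r(e)$ is finite. Then the network $(G-S,r)$ is in $\mathcal{O}_{HD}$ if and only if $(G,r)$ is in $\mathcal{O}_{HD}$.
   Context: A network is a pair $(G,r)$ where $G$ is an undirected multigraph and $r:E(G)\to\mathbb{R}_{>0}$ assigns a resistance to every edge; $c(e)=1/r(e)$ is the conductance. It is locally finite if every vertex of $G$ is incident with only finitely many edges. Here $G-S$ denotes the graph obtained from $G$ by deleting the edges in $S$ and then deleting all isolated vertices; $(G-S,r)$ carries the restriction of $r$. A potential is a function $h:V(G)\to\mathbb{R}$; its energy is $\sum_{e=vw\in E(G)} (h(v)-h(w))^2/r(e)$. A potential $h$ is harmonic if for every vertex $v$ the value $h(v)$ is the average of the values of $h$ at its neighbours weighted by conductances, i.e. $\sum_{e=vw}c(e)(h(v)-h(w))=0$ (sum over edges $e$ incident with $v$). A network is in $\mathcal{O}_{HD}$ if every harmonic function of finite energy on it is constant. *)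

theory Defs
  imports "HOL-Analysis.Analysis" "HOL-Library.Uprod"
begin

(* Undirected multigraphs. Every edge has an unordered pair of ends, so parallel edges
   are allowed, and so are loops (edges with ends Upair v v). *)

record ('v, 'e) multigraph =
  verts :: "'v set"
  edges :: "'e set"
  ends :: "'e \<Rightarrow> 'v uprod"

definition multigraph :: "('v, 'e) multigraph \<Rightarrow> bool" where
  "multigraph G \<longleftrightarrow> (\<forall>e\<in>edges G. set_uprod (ends G e) \<subseteq> verts G)"

definition incident_edges :: "('v, 'e) multigraph \<Rightarrow> 'v \<Rightarrow> 'e set" where
  "incident_edges G v = {e \<in> edges G. v \<in> set_uprod (ends G e)}"

definition locally_finite_graph :: "('v, 'e) multigraph \<Rightarrow> bool" where
  "locally_finite_graph G \<longleftrightarrow> (\<forall>v\<in>verts G. finite (incident_edges G v))"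

definition adjacency :: "('v, 'e) multigraph \<Rightarrow> ('v \<times> 'v) set" where
  "adjacency G = {(v, w). \<exists>e\<in>edges G. ends G e = Upair v w}"

(* The graph without vertices counts as connected. *)
definition connected_graph :: "('v, 'e) multigraph \<Rightarrow> bool" where
  "connected_graph G \<longleftrightarrow> (\<forall>v\<in>verts G. \<forall>w\<in>verts G. (v, w) \<in> (adjacency G)\<^sup>*)"

(* G - S: after deleting the edges, all vertices that are then isolated are deleted too. *)
definition delete_edges :: "('v, 'e) multigraph \<Rightarrow> 'e set \<Rightarrow> ('v, 'e) multigraph" where
  "delete_edges G S =
     \<lparr>verts = {v \<in> verts G. \<exists>e\<in>edges G - S. v \<in> set_uprod (ends G e)},
      edges = edges G - S,
      ends = ends G\<rparr>"

(* A network is given by a multigraph G and a function r of which only the values on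
   edges G matter; so the same r serves for subgraphs of G. Likewise only the values of a
   potential on verts G matter. *)
definition network :: "('v, 'e) multigraph \<Rightarrow> ('e \<Rightarrow> real) \<Rightarrow> bool" where
  "network G r \<longleftrightarrow> multigraph G \<and> (\<forall>e\<in>edges G. r e > 0)"

lift_definition sq_diff :: "('v \<Rightarrow> real) \<Rightarrow> 'v uprod \<Rightarrow> real"
  is "\<lambda>h (v, w). (h v - h w)\<^sup>2"
  by (auto simp: eq_upair_simps power2_commute)

lemma sq_diff_Upair [simp]: "sq_diff h (Upair v w) = (h v - h w)\<^sup>2"
  by transfer simp

(* The terms are nonnegative, so summability says exactly that the energy is finite. *)
definition finite_energy ::
    "('v, 'e) multigraph \<Rightarrow> ('e \<Rightarrow> real) \<Rightarrow> ('v \<Rightarrow> real) \<Rightarrow> bool" where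
  "finite_energy G r h \<longleftrightarrow> (\<lambda>e. sq_diff h (ends G e) / r e) summable_on edges G"

definition other_end :: "('v, 'e) multigraph \<Rightarrow> 'e \<Rightarrow> 'v \<Rightarrow> 'v" where
  "other_end G e v = (THE w. ends G e = Upair v w)"

lemma other_end_eq: "ends G e = Upair v w \<Longrightarrow> other_end G e v = w"
  by (auto simp: other_end_def)

(* Meaningful for locally finite G only: otherwise the sum may range over an infinite set. *)
definition harmonic ::
    "('v, 'e) multigraph \<Rightarrow> ('e \<Rightarrow> real) \<Rightarrow> ('v \<Rightarrow> real) \<Rightarrow> bool" where
  "harmonic G r h \<longleftrightarrow>
     (\<forall>v\<in>verts G. (\<Sum>e\<in>incident_edges G v. 1 / r e * (h v - h (other_end G e v))) = 0)"

definition O_HD :: "('v, 'e) multigraph \<Rightarrow> ('e \<Rightarrow> real) \<Rightarrow> bool" where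
  "O_HD G r \<longleftrightarrow> (\<forall>h. harmonic G r h \<and> finite_energy G r h \<longrightarrow> h constant_on verts G)"

end

(* A network is in O_HD iff every bounded function of finite energy is, up to an additive constant,
   a weak limit of finitely supported functions of bounded energy. One direction holds because a
   harmonic function h is orthogonal to finitely supported functions, hence to its own truncations T,
   while the inner product of T and h is at least the energy of T. For the other direction, minimise
   the energy among the finite perturbations of a given function; the limit of a minimising sequence
   is harmonic. The criterion only involves bounded functions, and these have finite energy on S
   because the conductances on S are summable; so it does not see the edges of S. *)

theory Submission
  imports Defs "HOL-Complex_Analysis.Great_Picard"
begin

section \<open>Gradients and energy\<close>

text \<open>Orienting the edges makes the difference of a potential along an edge linear in the potential,
  whereas \<^const>\<open>sq_diff\<close> only provides the square of this difference.\<close>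

definition orientation :: "('v, 'e) multigraph \<Rightarrow> 'e \<Rightarrow> 'v \<times> 'v" where
  "orientation G e = (SOME p. ends G e = Upair (fst p) (snd p))"

definition grad :: "('v, 'e) multigraph \<Rightarrow> ('v \<Rightarrow> real) \<Rightarrow> 'e \<Rightarrow> real" where
  "grad G h e = h (fst (orientation G e)) - h (snd (orientation G e))"

lemma ends_orientation:
  "ends G e = Upair (fst (orientation G e)) (snd (orientation G e))"
proof -
  obtain a b where "ends G e = Upair a b" by (rule uprod_exhaust)
  then have "\<exists>p. ends G e = Upair (fst p) (snd p)" by (intro exI[of _ "(a, b)"]) simp
  then show ?thesis unfolding orientation_def by (rule someI_ex)
qed

lemma set_ends_orientation:
  "set_uprod (ends G e) = {fst (orientation G e), snd (orientation G e)}"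
  by (subst ends_orientation) simp

lemma sq_diff_ends: "sq_diff h (ends G e) = (grad G h e)\<^sup>2"
  by (subst ends_orientation) (simp add: grad_def)

lemma grad_add: "grad G (\<lambda>v. f v + g v) e = grad G f e + grad G g e"
  and grad_diff: "grad G (\<lambda>v. f v - g v) e = grad G f e - grad G g e"
  and grad_cmult: "grad G (\<lambda>v. a * f v) e = a * grad G f e"
  and grad_sum: "grad G (\<lambda>v. \<Sum>i\<in>A. k i v) e = (\<Sum>i\<in>A. grad G (k i) e)"
  and grad_shift: "grad G (\<lambda>v. f v - a) e = grad G f e"
  by (simp_all add: grad_def algebra_simps sum_subtractf)

lemma orientation_in_verts:
  assumes "multigraph G" "e \<in> edges G"
  shows "fst (orientation G e) \<in> verts G" "snd (orientation G e) \<in> verts G"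
  using assms by (auto simp: multigraph_def set_ends_orientation)

lemma grad_cong:
  assumes "multigraph G" "e \<in> edges G" "\<And>v. v \<in> verts G \<Longrightarrow> f v = g v"
  shows "grad G f e = grad G g e"
  using orientation_in_verts[OF assms(1,2)] assms(3) by (simp add: grad_def)

lemma grad_eq_0_cong:
  assumes "\<And>v. v \<in> set_uprod (ends G e) \<Longrightarrow> f v = 0"
  shows "grad G f e = 0"
  using assms by (simp add: grad_def set_ends_orientation)

lemma abs_grad_diff_le:
  assumes "\<And>v. v \<in> set_uprod (ends G e) \<Longrightarrow> \<bar>f v - g v\<bar> \<le> d"
  shows "\<bar>grad G f e - grad G g e\<bar> \<le> 2 * d"
  using assms[of "fst (orientation G e)"] assms[of "snd (orientation G e)"]
  by (simp add: grad_def set_ends_orientation)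

lemma abs_grad_le:
  assumes "multigraph G" "e \<in> edges G" "\<And>v. v \<in> verts G \<Longrightarrow> \<bar>f v\<bar> \<le> M"
  shows "\<bar>grad G f e\<bar> \<le> 2 * M"
  using orientation_in_verts[OF assms(1,2), THEN assms(3)] by (simp add: grad_def)

text \<open>Reversing the orientation of \<open>e\<close> flips the sign of both factors, so the
  product does not depend on it and gives, up to the factor \<open>1 / r e\<close>, the term in
  \<open>harmonic\<close>. For a loop both sides vanish.\<close>

lemma grad_indicator_mult:
  assumes "v \<in> set_uprod (ends G e)"
  shows "grad G (\<lambda>u. of_bool (u = v)) e * grad G h e = h v - h (other_end G e v)"
proof -
  obtain a b where ab: "ends G e = Upair a b" "\<And>h. grad G h e = h a - h b"
    using ends_orientation[of G e] unfolding grad_def by blast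
  from ab(1) assms consider "v = a" | "v = b" by auto
  then show ?thesis
  proof cases
    case 1
    with ab(1) have "other_end G e v = b" by (simp add: other_end_eq)
    with 1 show ?thesis by (auto simp: ab(2))
  next
    case 2
    with ab(1) have "ends G e = Upair v a" by simp
    then have "other_end G e v = a" by (rule other_end_eq)
    with 2 show ?thesis by (auto simp: ab(2))
  qed
qed

definition energy :: "('v, 'e) multigraph \<Rightarrow> ('e \<Rightarrow> real) \<Rightarrow> ('v \<Rightarrow> real) \<Rightarrow> real" where
  "energy G r h = (\<Sum>\<^sub>\<infinity>e\<in>edges G. (grad G h e)\<^sup>2 / r e)"

lemma finite_energy_iff:
  "finite_energy G r h \<longleftrightarrow> (\<lambda>e. (grad G h e)\<^sup>2 / r e) summable_on edges G"
  by (simp add: finite_energy_def sq_diff_ends)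

lemma sum_le_energy:
  assumes "network G r" "finite_energy G r h" "finite F" "F \<subseteq> edges G"
  shows "(\<Sum>e\<in>F. (grad G h e)\<^sup>2 / r e) \<le> energy G r h"
  unfolding energy_def using assms
  by (intro finite_sum_le_infsum) (auto simp: finite_energy_iff network_def less_imp_le)

lemma finite_energyI:
  assumes "network G r"
    and "\<And>F. finite F \<Longrightarrow> F \<subseteq> edges G \<Longrightarrow> (\<Sum>e\<in>F. (grad G h e)\<^sup>2 / r e) \<le> K"
  shows "finite_energy G r h"
  unfolding finite_energy_iff
proof (rule nonneg_bounded_partial_sums_imp_summable_on)
  show "0 \<le> (grad G h e)\<^sup>2 / r e" if "e \<in> edges G" for e
    using assms(1) that by (simp add: network_def less_imp_le)
  show "\<forall>\<^sub>F F in finite_subsets_at_top (edges G). (\<Sum>e\<in>F. (grad G h e)\<^sup>2 / r e) \<le> K"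
    using assms(2) by (intro eventually_finite_subsets_at_top_weakI)
qed

lemma energy_contraction:
  assumes "network G r" "finite_energy G r g"
    and le: "\<And>e. e \<in> edges G \<Longrightarrow> \<bar>grad G f e\<bar> \<le> \<bar>grad G g e\<bar>"
  shows "finite_energy G r f" "energy G r f \<le> energy G r g"
proof -
  have le': "(grad G f e)\<^sup>2 / r e \<le> (grad G g e)\<^sup>2 / r e" if "e \<in> edges G" for e
    using assms(1) le[OF that] that
    by (intro divide_right_mono) (auto simp: abs_le_square_iff network_def less_imp_le)
  show "finite_energy G r f"
    unfolding finite_energy_iff using assms(1)
    by (intro summable_on_comparison_test[OF assms(2)[unfolded finite_energy_iff] le'])
      (auto simp: network_def less_imp_le)
  then show "energy G r f \<le> energy G r g"
    unfolding energy_def using assms(2) by (intro infsum_mono le') (auto simp: finite_energy_iff)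
qed

section \<open>Truncation of potentials\<close>

definition truncate_at :: "real \<Rightarrow> real \<Rightarrow> real" where
  "truncate_at M x = max (- M) (min M x)"

lemma abs_truncate_at_le: "M \<ge> 0 \<Longrightarrow> \<bar>truncate_at M x\<bar> \<le> M"
  by (auto simp: truncate_at_def)

lemma truncate_at_id: "\<bar>x\<bar> \<le> M \<Longrightarrow> truncate_at M x = x"
  by (auto simp: truncate_at_def)

lemma abs_truncate_at_diff_le: "\<bar>truncate_at M x - truncate_at M y\<bar> \<le> \<bar>x - y\<bar>"
  by (auto simp: truncate_at_def)

text \<open>Truncation is nondecreasing and 1-Lipschitz, so both increments have the same sign and
  the truncated one is the smaller in absolute value. Applied edge by edge, this makes the inner
  product of the truncation with \<open>h\<close> dominate the energy of the truncation.\<close>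

lemma truncate_at_monotone:
  "(truncate_at M x - truncate_at M y)\<^sup>2 \<le> (truncate_at M x - truncate_at M y) * (x - y)"
proof (cases "x \<le> y")
  case True
  then have "(truncate_at M y - truncate_at M x) * (truncate_at M y - truncate_at M x)
      \<le> (truncate_at M y - truncate_at M x) * (y - x)"
    by (intro mult_left_mono) (auto simp: truncate_at_def)
  then show ?thesis by (simp add: algebra_simps power2_eq_square)
next
  case False
  then show ?thesis unfolding power2_eq_square
    by (intro mult_left_mono) (auto simp: truncate_at_def)
qed

lemma abs_grad_truncate_at_le: "\<bar>grad G (\<lambda>v. truncate_at M (h v)) e\<bar> \<le> \<bar>grad G h e\<bar>"
  by (simp add: grad_def abs_truncate_at_diff_le)

lemma grad_truncate_at_monotone:
  "(grad G (\<lambda>v. truncate_at M (h v)) e)\<^sup>2 \<le> grad G (\<lambda>v. truncate_at M (h v)) e * grad G h e"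
  by (simp add: grad_def truncate_at_monotone)

section \<open>Harmonicity as orthogonality to finitely supported functions\<close>

lemma harmonic_iff:
  "harmonic G r h \<longleftrightarrow> (\<forall>v\<in>verts G.
     (\<Sum>e\<in>incident_edges G v. grad G (\<lambda>u. of_bool (u = v)) e * grad G h e / r e) = 0)"
  by (auto simp: harmonic_def incident_edges_def grad_indicator_mult intro!: sum.cong)

text \<open>On the vertices, \<open>g\<close> is a combination of indicators of points of
  \<open>A\<close>, and the pairing of \<open>h\<close> with the indicator of \<open>v\<close> is
  the harmonicity sum at \<open>v\<close>. The set \<open>B\<close> may contain further edges,
  because the indicator of \<open>v\<close> has zero gradient on edges not incident with
  \<open>v\<close>.\<close>

lemma harmonic_orthogonal:
  assumes "network G r" "locally_finite_graph G" "harmonic G r h"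
    and A: "finite A" "A \<subseteq> verts G" "\<And>v. v \<in> verts G - A \<Longrightarrow> g v = 0"
    and B: "finite B" "B \<subseteq> edges G" "\<And>v. v \<in> A \<Longrightarrow> incident_edges G v \<subseteq> B"
  shows "(\<Sum>e\<in>B. grad G g e * grad G h e / r e) = 0"
proof -
  have "grad G g e = (\<Sum>v\<in>A. g v * grad G (\<lambda>u. of_bool (u = v)) e)" if "e \<in> B" for e
  proof -
    have "grad G g e = grad G (\<lambda>u. \<Sum>v\<in>A. g v * of_bool (u = v)) e"
      using assms that by (intro grad_cong) (auto simp: network_def of_bool_def if_distrib cong: if_cong)
    then show ?thesis by (simp add: grad_sum grad_cmult)
  qed
  then have "(\<Sum>e\<in>B. grad G g e * grad G h e / r e)
      = (\<Sum>e\<in>B. \<Sum>v\<in>A. g v * (grad G (\<lambda>u. of_bool (u = v)) e * grad G h e / r e))"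
    by (intro sum.cong) (auto simp: sum_distrib_right sum_divide_distrib mult.assoc)
  also have "\<dots> = (\<Sum>v\<in>A. g v * (\<Sum>e\<in>B. grad G (\<lambda>u. of_bool (u = v)) e * grad G h e / r e))"
    by (subst sum.swap) (simp add: sum_distrib_left)
  also have "\<dots> = 0"
  proof (intro sum.neutral ballI)
    fix v assume "v \<in> A"
    have "(\<Sum>e\<in>B. grad G (\<lambda>u. of_bool (u = v)) e * grad G h e / r e)
        = (\<Sum>e\<in>incident_edges G v. grad G (\<lambda>u. of_bool (u = v)) e * grad G h e / r e)"
      using B \<open>v \<in> A\<close>
      by (intro sum.mono_neutral_right) (auto simp: incident_edges_def intro!: grad_eq_0_cong)
    also have "\<dots> = 0" using assms(3) A(2) \<open>v \<in> A\<close> by (auto simp: harmonic_iff)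
    finally show "g v * (\<Sum>e\<in>B. grad G (\<lambda>u. of_bool (u = v)) e * grad G h e / r e) = 0" by simp
  qed
  finally show ?thesis .
qed

section \<open>Weak limits of finitely supported functions\<close>

text \<open>This says that \<open>f\<close> is a limit of finitely supported functions in the weak topology of the
  Dirichlet space. Bounding the energies, rather than asking that the energy of \<open>g - f\<close> be
  small, makes the notion stable under truncation of \<open>g\<close>.\<close>

definition weakly_null ::
    "('v, 'e) multigraph \<Rightarrow> ('e \<Rightarrow> real) \<Rightarrow> ('v \<Rightarrow> real) \<Rightarrow> bool" where
  "weakly_null G r f \<longleftrightarrow> (\<exists>K. \<forall>F \<epsilon>. finite F \<longrightarrow> F \<subseteq> verts G \<longrightarrow> \<epsilon> > 0 \<longrightarrow>
     (\<exists>g. finite {v \<in> verts G. g v \<noteq> 0} \<and> (\<forall>v\<in>F. \<bar>g v - f v\<bar> \<le> \<epsilon>) \<and>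
        finite_energy G r g \<and> energy G r g \<le> K))"

text \<open>The pairing of \<open>f\<close> and \<open>h\<close> is morally a limit of pairings of
  \<open>g\<close> and \<open>h\<close>, which vanish by orthogonality; by \<open>mono\<close> its
  terms are nonnegative and dominate the energy terms of \<open>f\<close>. Since the approximation
  controls only finitely many vertices, the pairing is taken over a finite \<open>F\<close> that
  carries almost all the energy of \<open>h\<close>. Outside \<open>F\<close>, Cauchy-Schwarz
  applies with the bound \<open>K\<close> on the energies of the \<open>g\<close>.\<close>

lemma weakly_null_energy_zero:
  assumes G: "network G r" "locally_finite_graph G" and h: "harmonic G r h" "finite_energy G r h"
    and null: "weakly_null G r f"
    and mono: "\<And>e. e \<in> edges G \<Longrightarrow> (grad G f e)\<^sup>2 \<le> grad G f e * grad G h e"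
    and e: "e \<in> edges G"
  shows "grad G f e = 0"
proof -
  have rpos: "r e > 0" if "e \<in> edges G" for e
    using G that by (auto simp: network_def)
  define c where "c = (grad G f e)\<^sup>2 / r e"
  have "c \<ge> 0" using rpos[OF e] by (simp add: c_def)
  obtain K where K: "\<forall>F \<epsilon>. finite F \<longrightarrow> F \<subseteq> verts G \<longrightarrow> \<epsilon> > 0 \<longrightarrow>
      (\<exists>g. finite {v \<in> verts G. g v \<noteq> 0} \<and> (\<forall>v\<in>F. \<bar>g v - f v\<bar> \<le> \<epsilon>) \<and>
        finite_energy G r g \<and> energy G r g \<le> K)"
    using null unfolding weakly_null_def by (rule exE)
  have "K \<ge> 0"
  proof -
    obtain g where "finite_energy G r g" "energy G r g \<le> K"
      using K[rule_format, of "{}" 1] by auto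
    then show ?thesis using sum_le_energy[OF G(1), of g "{}"] by simp
  qed
  have small: "c\<^sup>2 \<le> K * \<eta>" if "\<eta> > 0" for \<eta>
  proof -
    have hs: "(\<lambda>e. (grad G h e)\<^sup>2 / r e) summable_on edges G"
      using h(2) by (simp add: finite_energy_iff)
    have "((\<lambda>e. (grad G h e)\<^sup>2 / r e) has_sum energy G r h) (edges G)"
      unfolding energy_def using hs by (rule has_sum_infsum)
    then have "\<forall>\<^sub>F F in finite_subsets_at_top (edges G).
        dist (\<Sum>e\<in>F. (grad G h e)\<^sup>2 / r e) (energy G r h) < \<eta>"
      unfolding has_sum_def using that by (rule tendstoD)
    then obtain F0 where F0: "finite F0" "F0 \<subseteq> edges G"
      "\<forall>F. finite F \<and> F0 \<subseteq> F \<and> F \<subseteq> edges G \<longrightarrow>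
        dist (\<Sum>e\<in>F. (grad G h e)\<^sup>2 / r e) (energy G r h) < \<eta>"
      unfolding eventually_finite_subsets_at_top by blast
    \<comment> \<open>The edge \<open>e\<close> is added so that its term can be compared with the
      sum over \<open>F\<close>.\<close>
    define F where "F = insert e F0"
    have F: "finite F" "F \<subseteq> edges G" "e \<in> F" using F0 e by (auto simp: F_def)
    define V where "V = (\<Union>e\<in>F. set_uprod (ends G e))"
    have V: "finite V" "V \<subseteq> verts G"
      using F G(1) by (auto simp: V_def network_def multigraph_def)
    have tail: "(\<Sum>e\<in>B - F. (grad G h e)\<^sup>2 / r e) \<le> \<eta>" if B: "finite B" "F \<subseteq> B" "B \<subseteq> edges G" for B
    proof -
      have "(\<Sum>e\<in>B. (grad G h e)\<^sup>2 / r e) \<le> energy G r h"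
        using B by (intro sum_le_energy G h) auto
      moreover have "dist (\<Sum>e\<in>F. (grad G h e)\<^sup>2 / r e) (energy G r h) < \<eta>"
        using F by (intro F0(3)[rule_format]) (auto simp: F_def)
      ultimately show ?thesis
        using B F by (simp add: sum_diff dist_real_def)
    qed
    \<comment> \<open>\<open>F\<close>, and hence \<open>S\<close>, depends on \<eta> but not on
      \<epsilon>, so the error \<open>\<epsilon> * (2 * S)\<close> disappears when \<epsilon> tends
      to 0.\<close>
    define S where "S = (\<Sum>e\<in>F. \<bar>grad G h e\<bar> / r e)"
    have "c \<le> sqrt (K * \<eta>) + \<epsilon> * (2 * S)" if "\<epsilon> > 0" for \<epsilon>
    proof -
      obtain g where g: "finite {v \<in> verts G. g v \<noteq> 0}" "\<And>v. v \<in> V \<Longrightarrow> \<bar>g v - f v\<bar> \<le> \<epsilon>"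
          "finite_energy G r g" "energy G r g \<le> K"
        using K[rule_format, OF V \<open>\<epsilon> > 0\<close>] by blast
      \<comment> \<open>On edges outside \<open>B\<close> the gradient of \<open>g\<close> vanishes.
        Orthogonality on \<open>B\<close> thus turns the sum over \<open>F\<close> into minus a tail
        sum, where \<open>h\<close> has energy at most \<eta>.\<close>
      define B where "B = F \<union> (\<Union>v\<in>{v \<in> verts G. g v \<noteq> 0}. incident_edges G v)"
      have B: "finite B" "F \<subseteq> B" "B \<subseteq> edges G"
        using F g(1) G(2) by (auto simp: B_def locally_finite_graph_def incident_edges_def)
      have "(\<Sum>e\<in>B. grad G g e * grad G h e / r e) = 0"
        using g(1) B by (intro harmonic_orthogonal[OF G h(1), of "{v \<in> verts G. g v \<noteq> 0}"]) (auto simp: B_def)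
      then have eq: "(\<Sum>e\<in>F. grad G g e * grad G h e / r e) = - (\<Sum>e\<in>B - F. grad G g e * grad G h e / r e)"
        using B F by (simp add: sum_diff)
      have "(\<Sum>e\<in>B - F. grad G g e * grad G h e / r e)\<^sup>2
          = (\<Sum>e\<in>B - F. (grad G g e / sqrt (r e)) * (grad G h e / sqrt (r e)))\<^sup>2"
        using B(3) rpos by (intro arg_cong[where f = "\<lambda>x. x\<^sup>2"] sum.cong)
          (auto simp: less_imp_le)
      also have "\<dots> \<le> (\<Sum>e\<in>B - F. (grad G g e / sqrt (r e))\<^sup>2) * (\<Sum>e\<in>B - F. (grad G h e / sqrt (r e))\<^sup>2)"
        by (rule Cauchy_Schwarz_ineq_sum)
      also have "\<dots> = (\<Sum>e\<in>B - F. (grad G g e)\<^sup>2 / r e) * (\<Sum>e\<in>B - F. (grad G h e)\<^sup>2 / r e)"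
        using B(3) rpos by (intro arg_cong2[where f = "(*)"] sum.cong)
          (auto simp: less_imp_le power_divide)
      also have "\<dots> \<le> K * \<eta>"
      proof (rule mult_mono)
        have "(\<Sum>e\<in>B - F. (grad G g e)\<^sup>2 / r e) \<le> energy G r g"
          using B by (intro sum_le_energy G g) auto
        with g(4) show "(\<Sum>e\<in>B - F. (grad G g e)\<^sup>2 / r e) \<le> K" by simp
        show "(\<Sum>e\<in>B - F. (grad G h e)\<^sup>2 / r e) \<le> \<eta>" by (rule tail[OF B])
        show "0 \<le> (\<Sum>e\<in>B - F. (grad G h e)\<^sup>2 / r e)"
          using B(3) rpos by (intro sum_nonneg) (auto simp: less_imp_le)
      qed (fact \<open>K \<ge> 0\<close>)
      finally have "\<bar>\<Sum>e\<in>B - F. grad G g e * grad G h e / r e\<bar> \<le> sqrt (K * \<eta>)"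
        by (rule real_le_rsqrt[of "\<bar>_\<bar>", simplified])
      then have 1: "(\<Sum>e\<in>F. grad G g e * grad G h e / r e) \<le> sqrt (K * \<eta>)"
        unfolding eq by linarith
      have "(\<Sum>e\<in>F. grad G f e * grad G h e / r e) - (\<Sum>e\<in>F. grad G g e * grad G h e / r e)
          = (\<Sum>e\<in>F. (grad G f e - grad G g e) * (grad G h e / r e))"
        by (simp add: sum_subtractf left_diff_distrib diff_divide_distrib)
      \<comment> \<open>Both ends of an edge of \<open>F\<close> lie in \<open>V\<close>, and each
        contributes an error of at most \<epsilon> to the gradient.\<close>
      also have "\<dots> \<le> (\<Sum>e\<in>F. 2 * \<epsilon> * (\<bar>grad G h e\<bar> / r e))"
      proof (intro sum_mono)
        fix e' assume e': "e' \<in> F"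
        have "(grad G f e' - grad G g e') * (grad G h e' / r e')
            \<le> \<bar>grad G f e' - grad G g e'\<bar> * \<bar>grad G h e' / r e'\<bar>"
          by (metis abs_ge_self abs_mult)
        also have "\<dots> \<le> 2 * \<epsilon> * \<bar>grad G h e' / r e'\<bar>"
        proof (intro mult_right_mono abs_grad_diff_le)
          fix v assume "v \<in> set_uprod (ends G e')"
          then have "v \<in> V" using e' by (auto simp: V_def)
          then show "\<bar>f v - g v\<bar> \<le> \<epsilon>" using g(2) by (simp add: abs_minus_commute)
        qed simp
        also have "\<dots> = 2 * \<epsilon> * (\<bar>grad G h e'\<bar> / r e')"
          using rpos[of e'] e' F(2) by auto
        finally show "(grad G f e' - grad G g e') * (grad G h e' / r e') \<le> 2 * \<epsilon> * (\<bar>grad G h e'\<bar> / r e')" .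
      qed
      also have "\<dots> = \<epsilon> * (2 * S)" by (simp add: S_def sum_distrib_left mult_ac)
      finally have 2: "(\<Sum>e\<in>F. grad G f e * grad G h e / r e) \<le> sqrt (K * \<eta>) + \<epsilon> * (2 * S)"
        using 1 by linarith
      have nn: "0 \<le> grad G f e * grad G h e / r e" if "e \<in> edges G" for e
        using mono[OF that] rpos[OF that] by (smt (verit) divide_nonneg_pos zero_le_power2)
      have "c \<le> grad G f e * grad G h e / r e"
        unfolding c_def using mono[OF e] rpos[OF e] by (simp add: divide_right_mono)
      also have "\<dots> \<le> (\<Sum>e\<in>F. grad G f e * grad G h e / r e)"
        using F nn by (intro member_le_sum) auto
      finally show ?thesis using 2 by linarith
    qed
    then have "\<forall>\<^sub>F \<epsilon> in at_right 0. c \<le> sqrt (K * \<eta>) + \<epsilon> * (2 * S)"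
      by (auto simp: eventually_at_filter)
    moreover have "((\<lambda>\<epsilon>. sqrt (K * \<eta>) + \<epsilon> * (2 * S)) \<longlongrightarrow> sqrt (K * \<eta>) + 0 * (2 * S)) (at_right 0)"
      by (intro tendsto_intros)
    ultimately have "c \<le> sqrt (K * \<eta>)"
      using tendsto_lowerbound[of _ "sqrt (K * \<eta>) + 0 * (2 * S)" "at_right (0::real)" c] by simp
    then have "c\<^sup>2 \<le> (sqrt (K * \<eta>))\<^sup>2" using \<open>c \<ge> 0\<close> by (rule power_mono)
    then show ?thesis using \<open>K \<ge> 0\<close> that by simp
  qed
  have "c\<^sup>2 \<le> \<epsilon>" if "\<epsilon> > 0" for \<epsilon>
  proof -
    \<comment> \<open>Dividing by \<open>K + 1\<close> rather than \<open>K\<close> covers the case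
      \<open>K = 0\<close>.\<close>
    have "c\<^sup>2 \<le> K * (\<epsilon> / (K + 1))" using \<open>K \<ge> 0\<close> that by (intro small) auto
    also have "\<dots> \<le> \<epsilon>" using \<open>K \<ge> 0\<close> that by (simp add: field_simps)
    finally show ?thesis .
  qed
  then have "c\<^sup>2 \<le> 0" by (rule field_le_epsilon[of _ 0, simplified])
  then show ?thesis using rpos[OF e] by (simp add: c_def)
qed

section \<open>The criterion and its sufficiency\<close>

lemma grad_zero_imp_constant:
  assumes "connected_graph G" and 0: "\<And>e. e \<in> edges G \<Longrightarrow> grad G h e = 0"
  shows "h constant_on verts G"
proof -
  have "h v = h w" if "(v, w) \<in> (adjacency G)\<^sup>*" for v w
    using that
  proof induction
    case (step w u)
    then obtain e where e: "e \<in> edges G" "ends G e = Upair w u" by (auto simp: adjacency_def)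
    have "h w = h u"
      using e(2) 0[OF e(1)] ends_orientation[of G e] by (auto simp: grad_def)
    with step show ?case by simp
  qed simp
  then have "h v = h w" if "v \<in> verts G" "w \<in> verts G" for v w
    using assms(1) that unfolding connected_graph_def by blast
  then show ?thesis
    unfolding constant_on_def by (cases "verts G = {}") blast+
qed

text \<open>In the Royden decomposition of a function of finite energy into a limit of finitely
  supported functions and a harmonic function, this asks that for bounded \<open>f\<close> the
  harmonic part can be chosen constant.\<close>

definition asymptotically_constant :: "('v, 'e) multigraph \<Rightarrow> ('e \<Rightarrow> real) \<Rightarrow> bool" where
  "asymptotically_constant G r \<longleftrightarrow> (\<forall>f M. (\<forall>v\<in>verts G. \<bar>f v\<bar> \<le> M) \<and> finite_energy G r f \<longrightarrow>
     (\<exists>c. weakly_null G r (\<lambda>v. f v - c)))"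

lemma asymptotically_constantD:
  assumes "asymptotically_constant G r" "finite_energy G r f" "\<And>v. v \<in> verts G \<Longrightarrow> \<bar>f v\<bar> \<le> M"
  shows "\<exists>c. weakly_null G r (\<lambda>v. f v - c)"
proof -
  from assms(2,3) have "(\<forall>v\<in>verts G. \<bar>f v\<bar> \<le> M) \<and> finite_energy G r f" by simp
  then show ?thesis by (rule assms(1)[unfolded asymptotically_constant_def, rule_format])
qed

text \<open>A harmonic \<open>h\<close> may be unbounded, so the criterion is applied to truncations
  of \<open>h\<close>, one for each edge, to show that the gradient vanishes there.\<close>

lemma O_HD_if_asymptotically_constant:
  assumes G: "network G r" "connected_graph G" "locally_finite_graph G"
    and ac: "asymptotically_constant G r"
  shows "O_HD G r"
  unfolding O_HD_def
proof (intro allI impI)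
  fix h assume h: "harmonic G r h \<and> finite_energy G r h"
  show "h constant_on verts G"
  proof (rule grad_zero_imp_constant[OF G(2)])
    fix e assume e: "e \<in> edges G"
    let ?v = "fst (orientation G e)" and ?w = "snd (orientation G e)"
    \<comment> \<open>At this level truncation changes \<open>h\<close> at neither end of
      \<open>e\<close>.\<close>
    define M where "M = max \<bar>h ?v\<bar> \<bar>h ?w\<bar>"
    let ?f = "\<lambda>v. truncate_at M (h v)"
    have "finite_energy G r ?f"
      using G(1) conjunct2[OF h] by (rule energy_contraction) (rule abs_grad_truncate_at_le)
    moreover have "\<bar>?f v\<bar> \<le> M" for v
      by (rule abs_truncate_at_le) (simp add: M_def)
    ultimately have "\<exists>c. weakly_null G r (\<lambda>v. ?f v - c)"
      by (rule asymptotically_constantD[OF ac])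
    then obtain c where "weakly_null G r (\<lambda>v. ?f v - c)" ..
    then have "grad G (\<lambda>v. ?f v - c) e = 0"
      by (rule weakly_null_energy_zero[OF G(1,3) conjunct1[OF h] conjunct2[OF h]])
        (simp_all only: grad_shift grad_truncate_at_monotone e)
    then have "grad G ?f e = 0" by (simp only: grad_shift)
    then show "grad G h e = 0"
      by (simp add: grad_def truncate_at_id M_def)
  qed
qed

section \<open>Minimising sequences\<close>

text \<open>All vertices are reached from one vertex by iterating finite neighbourhoods.
  Countability is what the diagonal subsequence argument below requires.\<close>

lemma countable_verts:
  assumes "connected_graph G" "locally_finite_graph G" "multigraph G"
  shows "countable (verts G)"
proof (cases "verts G = {}")
  case False
  then obtain v where v: "v \<in> verts G" by blast
  have nb: "countable (adjacency G `` {w})" for w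
  proof (cases "w \<in> verts G")
    case True
    have "adjacency G `` {w} \<subseteq> (\<Union>e\<in>incident_edges G w. set_uprod (ends G e))"
      by (force simp: adjacency_def incident_edges_def)
    moreover have "finite (\<Union>e\<in>incident_edges G w. set_uprod (ends G e))"
      using assms(2) True by (auto simp: locally_finite_graph_def)
    ultimately show ?thesis by (meson countable_finite finite_subset)
  next
    \<comment> \<open>Local finiteness speaks of vertices of \<open>G\<close> only; any other point
      has no neighbours at all.\<close>
    case False
    then have "adjacency G `` {w} = {}"
      using assms(3) by (force simp: adjacency_def multigraph_def)
    then show ?thesis by simp
  qed
  have "countable (adjacency G `` Y)" if "countable Y" for Y
  proof -
    have "adjacency G `` Y = (\<Union>w\<in>Y. adjacency G `` {w})" by blast
    then show ?thesis using nb that by simp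
  qed
  then have "countable ((adjacency G)\<^sup>* `` {v})"
    by (rule countable_rtrancl) simp_all
  moreover have "verts G \<subseteq> (adjacency G)\<^sup>* `` {v}"
    using assms(1) v by (auto simp: connected_graph_def)
  ultimately show ?thesis by (rule countable_subset[rotated])
qed simp

text \<open>By local finiteness only finitely many edges meet the set where \<open>g\<close> and
  \<open>f\<close> differ; on all others the gradients agree.\<close>

lemma finite_support_perturbation:
  assumes "network G r" "locally_finite_graph G" "finite_energy G r f"
    and "finite {v \<in> verts G. g v \<noteq> f v}"
  shows "finite_energy G r g"
proof -
  define B where "B = (\<Union>v\<in>{v \<in> verts G. g v \<noteq> f v}. incident_edges G v)"
  have B: "finite B" "B \<subseteq> edges G"
    using assms by (auto simp: B_def locally_finite_graph_def incident_edges_def)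
  have eq: "grad G g e = grad G f e" if "e \<in> edges G - B" for e
  proof -
    have "grad G (\<lambda>v. g v - f v) e = 0"
      using that assms(1)
      by (intro grad_eq_0_cong) (auto simp: B_def incident_edges_def network_def multigraph_def)
    then show ?thesis by (simp add: grad_diff)
  qed
  have "(\<lambda>e. (grad G g e)\<^sup>2 / r e) summable_on edges G - B"
  proof -
    have "(\<lambda>e. (grad G f e)\<^sup>2 / r e) summable_on edges G - B"
      using assms(3) unfolding finite_energy_iff by (rule summable_on_subset_banach) blast
    also have "?this \<longleftrightarrow> ?thesis"
      by (intro summable_on_cong) (simp add: eq)
    finally show ?thesis .
  qed
  moreover have "(\<lambda>e. (grad G g e)\<^sup>2 / r e) summable_on B"
    using B by (intro summable_on_finite)
  ultimately have "(\<lambda>e. (grad G g e)\<^sup>2 / r e) summable_on (edges G - B) \<union> B"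
    by (rule summable_on_Un_disjoint) blast
  moreover have "(edges G - B) \<union> B = edges G" using B by blast
  ultimately show ?thesis by (simp add: finite_energy_iff)
qed

text \<open>Only the finitely many edges at \<open>v\<close> change their terms. The linear
  coefficient in \<open>t\<close> is twice the harmonicity sum at \<open>v\<close>, so harmonicity
  is the Euler-Lagrange equation of the energy.\<close>

lemma energy_single_vertex_variation:
  assumes "network G r" "locally_finite_graph G" "finite_energy G r g" "v \<in> verts G"
  shows "energy G r (\<lambda>u. g u + t * of_bool (u = v)) = energy G r g
    + 2 * t * (\<Sum>e\<in>incident_edges G v. grad G (\<lambda>u. of_bool (u = v)) e * grad G g e / r e)
    + t\<^sup>2 * (\<Sum>e\<in>incident_edges G v. (grad G (\<lambda>u. of_bool (u = v)) e)\<^sup>2 / r e)"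
proof -
  let ?\<delta> = "\<lambda>u. of_bool (u = v) :: real"
  let ?g = "\<lambda>u. g u + t * ?\<delta> u"
  have "finite {u \<in> verts G. ?g u \<noteq> g u}"
    by (rule finite_subset[of _ "{v}"]) auto
  then have fin: "finite_energy G r ?g"
    by (rule finite_support_perturbation[OF assms(1-3)])
  have "energy G r ?g - energy G r g
      = (\<Sum>\<^sub>\<infinity>e\<in>edges G. (grad G ?g e)\<^sup>2 / r e - (grad G g e)\<^sup>2 / r e)"
    using infsum_add[of "\<lambda>e. (grad G ?g e)\<^sup>2 / r e" "edges G" "\<lambda>e. - ((grad G g e)\<^sup>2 / r e)"]
      fin assms(3)
    by (simp add: energy_def finite_energy_iff summable_on_uminus infsum_uminus)
  also have "\<dots> = (\<Sum>\<^sub>\<infinity>e\<in>incident_edges G v. (grad G ?g e)\<^sup>2 / r e - (grad G g e)\<^sup>2 / r e)"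
  proof (rule infsum_cong_neutral)
    fix e assume "e \<in> edges G - incident_edges G v"
    then have "grad G ?\<delta> e = 0" by (intro grad_eq_0_cong) (auto simp: incident_edges_def)
    then show "(grad G ?g e)\<^sup>2 / r e - (grad G g e)\<^sup>2 / r e = 0"
      by (simp add: grad_add grad_cmult)
  qed (auto simp: incident_edges_def)
  also have "\<dots> = (\<Sum>e\<in>incident_edges G v. (grad G ?g e)\<^sup>2 / r e - (grad G g e)\<^sup>2 / r e)"
    using assms by (intro infsum_finite) (auto simp: locally_finite_graph_def)
  also have "\<dots> = (\<Sum>e\<in>incident_edges G v. 2 * t * (grad G ?\<delta> e * grad G g e / r e)
      + t\<^sup>2 * ((grad G ?\<delta> e)\<^sup>2 / r e))"
    by (intro sum.cong refl)
      (simp add: grad_add grad_cmult power2_eq_square diff_divide_distrib[symmetric]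
        add_divide_distrib[symmetric] algebra_simps)
  also have "\<dots> = 2 * t * (\<Sum>e\<in>incident_edges G v. grad G ?\<delta> e * grad G g e / r e)
      + t\<^sup>2 * (\<Sum>e\<in>incident_edges G v. (grad G ?\<delta> e)\<^sup>2 / r e)"
    by (simp add: sum.distrib sum_distrib_left)
  finally show ?thesis by simp
qed

lemma linear_term_zero:
  fixes a b :: real
  assumes "\<And>t. 0 \<le> 2 * t * a + t\<^sup>2 * b"
  shows "a = 0"
proof -
  have "b \<ge> 0" using assms[of 1] assms[of "-1"] by simp
  \<comment> \<open>This \<open>t\<close> imitates the minimiser \<open>- a / b\<close> but also
    makes sense for \<open>b = 0\<close>.\<close>
  have "0 \<le> 2 * (- a / (b + 1)) * a + (- a / (b + 1))\<^sup>2 * b" by (rule assms)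
  also have "\<dots> = - a\<^sup>2 * (b + 2) / (b + 1)\<^sup>2"
    using \<open>b \<ge> 0\<close> by (simp add: power2_eq_square divide_simps) (simp add: algebra_simps)
  finally have nonneg: "0 \<le> - a\<^sup>2 * (b + 2) / (b + 1)\<^sup>2" .
  show ?thesis
  proof (rule ccontr)
    assume "a \<noteq> 0"
    then have "0 < a\<^sup>2 * (b + 2) / (b + 1)\<^sup>2"
      using \<open>b \<ge> 0\<close> by (intro divide_pos_pos mult_pos_pos) auto
    with nonneg show False by simp
  qed
qed

text \<open>A minimising sequence among the finite perturbations of \<open>f\<close> has a pointwise
  limit \<open>h\<close> that is harmonic of finite energy, hence a constant \<open>c\<close>. The
  differences of \<open>f\<close> and the sequence are then finitely supported, of bounded energy,
  and tend to \<open>f - c\<close>.\<close>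

lemma asymptotically_constant_if_O_HD:
  assumes G: "network G r" "connected_graph G" "locally_finite_graph G"
    and O: "O_HD G r"
  shows "asymptotically_constant G r"
  unfolding asymptotically_constant_def
proof (intro allI impI)
  fix f M assume "(\<forall>v\<in>verts G. \<bar>f v\<bar> \<le> M) \<and> finite_energy G r f"
  \<comment> \<open>The absolute value matters when there are no vertices: then \<open>M\<close> may
    be negative, but the truncation level must not be.\<close>
  then have fM: "\<And>v. v \<in> verts G \<Longrightarrow> \<bar>f v\<bar> \<le> \<bar>M\<bar>" and f: "finite_energy G r f" by force+
  have rpos: "r e > 0" if "e \<in> edges G" for e
    using G that by (auto simp: network_def)
  then have rnz: "r e \<noteq> 0" if "e \<in> edges G" for e
    using that by fastforce
  define A where "A = {g. finite {v \<in> verts G. g v \<noteq> f v}}"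
  have fin: "finite_energy G r g" if "g \<in> A" for g
    using finite_support_perturbation[OF G(1,3) f] that by (simp add: A_def)
  have nonneg: "0 \<le> energy G r g" for g
    unfolding energy_def using rpos by (intro infsum_nonneg) (auto simp: less_imp_le)
  define I where "I = (INF g\<in>A. energy G r g)"
  have bdd: "bdd_below (energy G r ` A)" by (rule bdd_belowI[of _ 0]) (auto simp: nonneg)
  have I_le: "I \<le> energy G r g" if "g \<in> A" for g
    unfolding I_def using bdd that by (rule cINF_lower)
  have "f \<in> A" by (simp add: A_def)
  have "\<exists>g\<in>A. energy G r g < I + 1 / real (Suc n)" for n
    using cINF_less_iff[OF _ bdd, of "I + 1 / real (Suc n)"] \<open>f \<in> A\<close> unfolding I_def by fastforce
  then obtain g0 where g0: "\<And>n. g0 n \<in> A" "\<And>n. energy G r (g0 n) < I + 1 / real (Suc n)"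
    by metis
  \<comment> \<open>Truncation keeps the sequence in \<open>A\<close> since \<open>f\<close> is bounded, and provides the uniform bound
    needed for a pointwise convergent subsequence.\<close>
  define g where "g n v = truncate_at \<bar>M\<bar> (g0 n v)" for n v
  have gA: "g n \<in> A" for n
  proof -
    have "{v \<in> verts G. g n v \<noteq> f v} \<subseteq> {v \<in> verts G. g0 n v \<noteq> f v}"
      using fM by (auto simp: g_def truncate_at_id)
    moreover have "finite {v \<in> verts G. g0 n v \<noteq> f v}" using g0(1)[of n] by (simp add: A_def)
    ultimately have "finite {v \<in> verts G. g n v \<noteq> f v}" by (rule finite_subset)
    then show ?thesis by (simp add: A_def)
  qed
  have gE: "energy G r (g n) < I + 1 / real (Suc n)" for n
  proof -
    have "energy G r (g n) \<le> energy G r (g0 n)"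
      unfolding g_def by (rule energy_contraction[OF G(1) fin[OF g0(1)]]) (rule abs_grad_truncate_at_le)
    with g0(2)[of n] show ?thesis by simp
  qed
  have "countable (verts G)" using G by (intro countable_verts) (auto simp: network_def)
  \<comment> \<open>Bolzano-Weierstrass at each vertex and a diagonal choice over the countably many
    vertices.\<close>
  then obtain k where k: "strict_mono k" "\<And>v. v \<in> verts G \<Longrightarrow> \<exists>l. (\<lambda>n. g (k n) v) \<longlonglongrightarrow> l"
    by (rule function_convergent_subsequence[of "verts G" g "\<bar>M\<bar>"]) (auto simp: g_def abs_truncate_at_le)
  define h where "h v = lim (\<lambda>n. g (k n) v)" for v
  have lim: "(\<lambda>n. g (k n) v) \<longlonglongrightarrow> h v" if "v \<in> verts G" for v
    using k(2)[OF that] by (auto simp: h_def limI)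
  have grad_lim: "(\<lambda>n. grad G (g (k n)) e) \<longlonglongrightarrow> grad G h e" if "e \<in> edges G" for e
    unfolding grad_def using that G(1)
    by (intro tendsto_diff lim orientation_in_verts) (auto simp: network_def)
  have E_le: "energy G r (g n) \<le> I + 1" for n
    by (rule order.trans[OF less_imp_le[OF gE]]) simp
  \<comment> \<open>As in Fatou's lemma: finite partial sums pass to the limit and keep the uniform
    bound.\<close>
  have hE: "finite_energy G r h"
  proof (rule finite_energyI[OF G(1)])
    fix F assume F: "finite F" "F \<subseteq> edges G"
    have "(\<lambda>n. \<Sum>e\<in>F. (grad G (g (k n)) e)\<^sup>2 / r e) \<longlonglongrightarrow> (\<Sum>e\<in>F. (grad G h e)\<^sup>2 / r e)"
      using F(2) by (intro tendsto_intros grad_lim) (auto simp: rnz subsetD)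
    moreover have "(\<Sum>e\<in>F. (grad G (g (k n)) e)\<^sup>2 / r e) \<le> I + 1" for n
      using sum_le_energy[OF G(1) fin[OF gA] F] E_le by (rule order.trans)
    ultimately show "(\<Sum>e\<in>F. (grad G h e)\<^sup>2 / r e) \<le> I + 1"
      by (intro LIMSEQ_le_const2) auto
  qed
  have "harmonic G r h"
    unfolding harmonic_iff
  proof (intro ballI)
    fix v assume v: "v \<in> verts G"
    let ?\<delta> = "\<lambda>u. of_bool (u = v) :: real"
    let ?L = "\<lambda>g. \<Sum>e\<in>incident_edges G v. grad G ?\<delta> e * grad G g e / r e"
    let ?C = "\<Sum>e\<in>incident_edges G v. (grad G ?\<delta> e)\<^sup>2 / r e"
    show "?L h = 0"
    proof (rule linear_term_zero)
      fix t
      \<comment> \<open>The varied function stays in \<open>A\<close>, so its energy is at least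
        \<open>I\<close>, while \<open>g (k n)\<close> exceeds \<open>I\<close> by less than
        \<open>1 / real (Suc (k n))\<close>.\<close>
      have ineq: "0 \<le> 1 / real (Suc (k n)) + 2 * t * ?L (g (k n)) + t\<^sup>2 * ?C" for n
      proof -
        have "{u \<in> verts G. g (k n) u + t * ?\<delta> u \<noteq> f u} \<subseteq> insert v {u \<in> verts G. g (k n) u \<noteq> f u}"
          by auto
        moreover have "finite (insert v {u \<in> verts G. g (k n) u \<noteq> f u})"
          using gA[of "k n"] by (simp add: A_def)
        ultimately have "finite {u \<in> verts G. g (k n) u + t * ?\<delta> u \<noteq> f u}"
          by (rule finite_subset)
        then have "(\<lambda>u. g (k n) u + t * ?\<delta> u) \<in> A" by (simp only: A_def mem_Collect_eq)
        then have "I \<le> energy G r (\<lambda>u. g (k n) u + t * ?\<delta> u)" by (rule I_le)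
        also have "\<dots> = energy G r (g (k n)) + 2 * t * ?L (g (k n)) + t\<^sup>2 * ?C"
          using G(1,3) fin[OF gA] v by (rule energy_single_vertex_variation)
        finally show ?thesis using gE[of "k n"] by linarith
      qed
      have "(\<lambda>n. 1 / real (Suc (k n))) \<longlonglongrightarrow> 0"
        using LIMSEQ_subseq_LIMSEQ[OF LIMSEQ_inverse_real_of_nat k(1)]
        by (simp add: o_def inverse_eq_divide)
      \<comment> \<open>Only the finitely many edges at \<open>v\<close> occur, so pointwise
        convergence suffices.\<close>
      moreover have "(\<lambda>n. ?L (g (k n))) \<longlonglongrightarrow> ?L h"
        by (intro tendsto_intros grad_lim) (auto simp: incident_edges_def rnz)
      ultimately have "(\<lambda>n. 1 / real (Suc (k n)) + 2 * t * ?L (g (k n)) + t\<^sup>2 * ?C)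
          \<longlonglongrightarrow> 0 + 2 * t * ?L h + t\<^sup>2 * ?C"
        by (intro tendsto_add tendsto_mult_left tendsto_const)
      then have "0 \<le> 0 + 2 * t * ?L h + t\<^sup>2 * ?C"
        by (rule LIMSEQ_le_const) (use ineq in blast)
      then show "0 \<le> 2 * t * ?L h + t\<^sup>2 * ?C" by simp
    qed
  qed
  with hE O have "h constant_on verts G" by (auto simp: O_HD_def)
  then obtain c where c: "\<And>v. v \<in> verts G \<Longrightarrow> h v = c" by (auto simp: constant_on_def)
  have "weakly_null G r (\<lambda>v. f v - c)"
    unfolding weakly_null_def
  \<comment> \<open>The bound comes from
    \<open>(a - b)\<^sup>2 \<le> 2 * a\<^sup>2 + 2 * b\<^sup>2\<close> on each edge, together with
    \<open>E_le\<close>.\<close>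
  proof (intro exI[of _ "2 * energy G r f + 2 * (I + 1)"] allI impI)
    fix F :: "'a set" and \<epsilon> :: real
    assume F: "finite F" "F \<subseteq> verts G" "\<epsilon> > 0"
    have "\<forall>\<^sub>F n in sequentially. \<forall>v\<in>F. dist (g (k n) v) (h v) < \<epsilon>"
      using F lim by (intro eventually_ball_finite ballI tendstoD) auto
    then obtain n where n: "\<And>v. v \<in> F \<Longrightarrow> dist (g (k n) v) (h v) < \<epsilon>"
      using eventually_happens'[OF sequentially_bot] by blast
    let ?u = "\<lambda>v. f v - g (k n) v"
    have "{v \<in> verts G. ?u v \<noteq> 0} = {v \<in> verts G. g (k n) v \<noteq> f v}" by auto
    then have supp: "finite {v \<in> verts G. ?u v \<noteq> 0}"
      using gA[of "k n"] by (simp add: A_def)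
    have near: "\<forall>v\<in>F. \<bar>?u v - (f v - c)\<bar> \<le> \<epsilon>"
    proof
      fix v assume "v \<in> F"
      with n[of v] c[of v] F show "\<bar>?u v - (f v - c)\<bar> \<le> \<epsilon>"
        by (auto simp: dist_real_def abs_minus_commute)
    qed
    have le: "(grad G ?u e)\<^sup>2 / r e \<le> 2 * ((grad G f e)\<^sup>2 / r e) + 2 * ((grad G (g (k n)) e)\<^sup>2 / r e)"
      if "e \<in> edges G" for e
    proof -
      have "(grad G ?u e)\<^sup>2 \<le> 2 * (grad G f e)\<^sup>2 + 2 * (grad G (g (k n)) e)\<^sup>2"
        using zero_le_power2[of "grad G f e + grad G (g (k n)) e"]
        by (simp add: grad_diff power2_eq_square algebra_simps)
      then have "(grad G ?u e)\<^sup>2 / r e \<le> (2 * (grad G f e)\<^sup>2 + 2 * (grad G (g (k n)) e)\<^sup>2) / r e"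
        using rpos[OF that] by (simp add: divide_right_mono)
      then show ?thesis by (simp add: add_divide_distrib)
    qed
    have sf: "(\<lambda>e. 2 * ((grad G f e)\<^sup>2 / r e)) summable_on edges G"
      using f unfolding finite_energy_iff by (rule summable_on_cmult_right)
    have sg: "(\<lambda>e. 2 * ((grad G (g (k n)) e)\<^sup>2 / r e)) summable_on edges G"
      using fin[OF gA] unfolding finite_energy_iff by (rule summable_on_cmult_right)
    have uE: "finite_energy G r ?u"
      unfolding finite_energy_iff using rpos
      by (intro summable_on_comparison_test[OF summable_on_add[OF sf sg] le]) (auto simp: less_imp_le)
    have "energy G r ?u \<le> (\<Sum>\<^sub>\<infinity>e\<in>edges G. 2 * ((grad G f e)\<^sup>2 / r e) + 2 * ((grad G (g (k n)) e)\<^sup>2 / r e))"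
      unfolding energy_def
      by (intro infsum_mono summable_on_add sf sg le uE[unfolded finite_energy_iff])
    also have "\<dots> = 2 * energy G r f + 2 * energy G r (g (k n))"
      unfolding energy_def by (simp only: infsum_add[OF sf sg] infsum_cmult_right')
    also have "\<dots> \<le> 2 * energy G r f + 2 * (I + 1)" using E_le[of "k n"] by simp
    finally have "energy G r ?u \<le> 2 * energy G r f + 2 * (I + 1)" .
    with supp near uE
    show "\<exists>g. finite {v \<in> verts G. g v \<noteq> 0} \<and> (\<forall>v\<in>F. \<bar>g v - (f v - c)\<bar> \<le> \<epsilon>) \<and>
        finite_energy G r g \<and> energy G r g \<le> 2 * energy G r f + 2 * (I + 1)"
      by (intro exI[of _ ?u] conjI)
  qed
  then show "\<exists>c. weakly_null G r (\<lambda>v. f v - c)" ..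
qed

section \<open>Deleting edges of finite total conductance\<close>

lemma verts_delete_edges: "verts (delete_edges G S) \<subseteq> verts G"
  and edges_delete_edges [simp]: "edges (delete_edges G S) = edges G - S"
  and grad_delete_edges [simp]: "grad (delete_edges G S) = grad G"
  by (auto simp: delete_edges_def grad_def[abs_def] orientation_def[abs_def])

lemma network_delete_edges: "network G r \<Longrightarrow> network (delete_edges G S) r"
  by (auto simp: network_def multigraph_def delete_edges_def)

lemma locally_finite_delete_edges:
  "locally_finite_graph G \<Longrightarrow> locally_finite_graph (delete_edges G S)"
  unfolding locally_finite_graph_def incident_edges_def delete_edges_def
  by (auto elim!: finite_subset[rotated])

lemma energy_delete_edges:
  assumes "network G r" "S \<subseteq> edges G" "finite_energy G r h"
  shows "finite_energy (delete_edges G S) r h" "energy (delete_edges G S) r h \<le> energy G r h"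
proof -
  have s: "(\<lambda>e. (grad G h e)\<^sup>2 / r e) summable_on edges G - S"
    using assms(3) unfolding finite_energy_iff by (rule summable_on_subset_banach) blast
  then show "finite_energy (delete_edges G S) r h" by (simp add: finite_energy_iff)
  show "energy (delete_edges G S) r h \<le> energy G r h"
    unfolding energy_def using assms s
    by (auto intro!: infsum_mono_neutral simp: finite_energy_iff network_def less_imp_le)
qed

text \<open>A potential bounded by \<open>M\<close> varies by at most \<open>2 * M\<close> along an
  edge, so an edge \<open>e\<close> of \<open>S\<close> adds at most
  \<open>4 * M\<^sup>2 / r e\<close>. This is where the finite total conductance of \<open>S\<close>
  enters.\<close>

lemma energy_add_edges:
  assumes G: "network G r" "S \<subseteq> edges G" "(\<lambda>e. 1 / r e) summable_on S"
    and h: "\<And>v. v \<in> verts G \<Longrightarrow> \<bar>h v\<bar> \<le> M" "finite_energy (delete_edges G S) r h"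
  shows "finite_energy G r h"
    "energy G r h \<le> energy (delete_edges G S) r h + 4 * M\<^sup>2 * (\<Sum>\<^sub>\<infinity>e\<in>S. 1 / r e)"
proof -
  have rpos: "r e > 0" if "e \<in> edges G" for e
    using G that by (auto simp: network_def)
  have le: "(grad G h e)\<^sup>2 / r e \<le> 4 * M\<^sup>2 * (1 / r e)" if "e \<in> S" for e
  proof -
    have e: "e \<in> edges G" using that G(2) by blast
    have "\<bar>grad G h e\<bar> \<le> 2 * M"
      using G(1) e h(1) by (intro abs_grad_le) (auto simp: network_def)
    then have "(grad G h e)\<^sup>2 \<le> (2 * M)\<^sup>2"
      by (metis abs_ge_zero power2_abs power_mono)
    then show ?thesis using rpos[OF e] by (simp add: divide_right_mono power_mult_distrib)
  qed
  have s1: "(\<lambda>e. 4 * M\<^sup>2 * (1 / r e)) summable_on S"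
    by (intro summable_on_cmult_right G)
  have s2: "(\<lambda>e. (grad G h e)\<^sup>2 / r e) summable_on S"
    using G(2) rpos by (intro summable_on_comparison_test[OF s1 le]) (auto simp: less_imp_le)
  have s3: "(\<lambda>e. (grad G h e)\<^sup>2 / r e) summable_on edges G - S"
    using h(2) by (simp add: finite_energy_iff)
  have un: "(edges G - S) \<union> S = edges G" using G(2) by blast
  show "finite_energy G r h"
    using summable_on_Un_disjoint[OF s3 s2] un by (auto simp: finite_energy_iff)
  have "energy G r h = energy (delete_edges G S) r h + (\<Sum>\<^sub>\<infinity>e\<in>S. (grad G h e)\<^sup>2 / r e)"
    using infsum_Un_disjoint[OF s3 s2] un by (auto simp: energy_def)
  also have "(\<Sum>\<^sub>\<infinity>e\<in>S. (grad G h e)\<^sup>2 / r e) \<le> (\<Sum>\<^sub>\<infinity>e\<in>S. 4 * M\<^sup>2 * (1 / r e))"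
    by (intro infsum_mono s1 s2 le)
  also have "\<dots> = 4 * M\<^sup>2 * (\<Sum>\<^sub>\<infinity>e\<in>S. 1 / r e)" by (rule infsum_cmult_right')
  finally show "energy G r h \<le> energy (delete_edges G S) r h + 4 * M\<^sup>2 * (\<Sum>\<^sub>\<infinity>e\<in>S. 1 / r e)"
    by simp
qed

section \<open>Invariance of the criterion under deletion of the edges\<close>

lemma finite_energy_cong:
  assumes "network G r" "\<And>v. v \<in> verts G \<Longrightarrow> f v = g v"
  shows "finite_energy G r f \<longleftrightarrow> finite_energy G r g"
  using assms unfolding finite_energy_iff
  by (intro summable_on_cong) (metis grad_cong network_def)

text \<open>A bounded function of finite energy on \<open>G - S\<close> also has finite energy on
  \<open>G\<close>; its approximants on \<open>G\<close> serve on \<open>G - S\<close>, since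
  deleting edges only lowers their energies.\<close>

lemma asymptotically_constant_delete_edges:
  assumes G: "network G r" "S \<subseteq> edges G" "(\<lambda>e. 1 / r e) summable_on S"
    and ac: "asymptotically_constant G r"
  shows "asymptotically_constant (delete_edges G S) r"
  unfolding asymptotically_constant_def
proof (intro allI impI)
  let ?H = "delete_edges G S"
  fix f M assume f: "(\<forall>v\<in>verts ?H. \<bar>f v\<bar> \<le> M) \<and> finite_energy ?H r f"
  \<comment> \<open>Nothing is known about \<open>f\<close> at deleted vertices; the value 0 there
    gives a bounded function on \<open>G\<close> without changing the energy on
    \<open>G - S\<close>.\<close>
  define f' where "f' v = (if v \<in> verts ?H then f v else 0)" for v
  have "finite_energy ?H r f'"
    using f finite_energy_cong[OF network_delete_edges[OF G(1)], of S f f'] by (simp add: f'_def)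
  moreover have bound: "\<bar>f' v\<bar> \<le> \<bar>M\<bar>" for v using f by (force simp: f'_def)
  ultimately have "finite_energy G r f'" using energy_add_edges[OF G] by blast
  then have "\<exists>c. weakly_null G r (\<lambda>v. f' v - c)"
    using bound by (rule asymptotically_constantD[OF ac])
  then obtain c where "weakly_null G r (\<lambda>v. f' v - c)" ..
  then obtain K where K: "\<forall>F \<epsilon>. finite F \<longrightarrow> F \<subseteq> verts G \<longrightarrow> \<epsilon> > 0 \<longrightarrow>
      (\<exists>g. finite {v \<in> verts G. g v \<noteq> 0} \<and> (\<forall>v\<in>F. \<bar>g v - (f' v - c)\<bar> \<le> \<epsilon>) \<and>
        finite_energy G r g \<and> energy G r g \<le> K)"
    unfolding weakly_null_def by (rule exE)
  have "weakly_null ?H r (\<lambda>v. f v - c)"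
    unfolding weakly_null_def
  proof (intro exI[of _ K] allI impI)
    fix F :: "'a set" and \<epsilon> :: real
    assume F: "finite F" "F \<subseteq> verts ?H" "\<epsilon> > 0"
    then have "F \<subseteq> verts G" using verts_delete_edges by fast
    then obtain g where g: "finite {v \<in> verts G. g v \<noteq> 0}" "\<forall>v\<in>F. \<bar>g v - (f' v - c)\<bar> \<le> \<epsilon>"
        "finite_energy G r g" "energy G r g \<le> K"
      using K[rule_format, of F \<epsilon>] F by blast
    have "finite {v \<in> verts ?H. g v \<noteq> 0}"
      using g(1) by (rule finite_subset[rotated]) (use verts_delete_edges in fast)
    moreover have "\<forall>v\<in>F. \<bar>g v - (f v - c)\<bar> \<le> \<epsilon>"
      using g(2) subsetD[OF F(2)] by (simp add: f'_def)
    ultimately show "\<exists>g. finite {v \<in> verts ?H. g v \<noteq> 0} \<and> (\<forall>v\<in>F. \<bar>g v - (f v - c)\<bar> \<le> \<epsilon>) \<and>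
        finite_energy ?H r g \<and> energy ?H r g \<le> K"
      using energy_delete_edges[OF G(1,2) g(3)] g(4) by (meson order.trans)
  qed
  then show "\<exists>c. weakly_null ?H r (\<lambda>v. f v - c)" ..
qed

text \<open>The approximants \<open>g0\<close> on \<open>G - S\<close> may be unbounded, so their
  energy on \<open>S\<close> is not controlled. Truncating them at a bound \<open>N\<close> for
  \<open>f - c\<close> keeps them close to \<open>f - c\<close> and limits the cost of
  \<open>S\<close> by a constant that depends neither on the finite set nor on \<epsilon>.\<close>

lemma asymptotically_constant_add_edges:
  assumes G: "network G r" "S \<subseteq> edges G" "(\<lambda>e. 1 / r e) summable_on S"
    and ac: "asymptotically_constant (delete_edges G S) r"
  shows "asymptotically_constant G r"
  unfolding asymptotically_constant_def
proof (intro allI impI)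
  let ?H = "delete_edges G S"
  have H: "network ?H r" using G(1) by (rule network_delete_edges)
  fix f M assume f: "(\<forall>v\<in>verts G. \<bar>f v\<bar> \<le> M) \<and> finite_energy G r f"
  then have "finite_energy ?H r f" "\<And>v. v \<in> verts ?H \<Longrightarrow> \<bar>f v\<bar> \<le> M"
    using energy_delete_edges[OF G(1,2)] verts_delete_edges[of G S] by auto
  then have "\<exists>c. weakly_null ?H r (\<lambda>v. f v - c)"
    by (rule asymptotically_constantD[OF ac])
  then obtain c where "weakly_null ?H r (\<lambda>v. f v - c)" ..
  then obtain K where K: "\<forall>F \<epsilon>. finite F \<longrightarrow> F \<subseteq> verts ?H \<longrightarrow> \<epsilon> > 0 \<longrightarrow>
      (\<exists>g. finite {v \<in> verts ?H. g v \<noteq> 0} \<and> (\<forall>v\<in>F. \<bar>g v - (f v - c)\<bar> \<le> \<epsilon>) \<and>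
        finite_energy ?H r g \<and> energy ?H r g \<le> K)"
    unfolding weakly_null_def by (rule exE)
  define N where "N = \<bar>M\<bar> + \<bar>c\<bar>"
  have "N \<ge> 0" by (simp add: N_def)
  have fN: "\<bar>f v - c\<bar> \<le> N" if "v \<in> verts G" for v
    using f that by (force simp: N_def)
  have "weakly_null G r (\<lambda>v. f v - c)"
    unfolding weakly_null_def
  proof (intro exI[of _ "K + 4 * N\<^sup>2 * (\<Sum>\<^sub>\<infinity>e\<in>S. 1 / r e)"] allI impI)
    fix F :: "'a set" and \<epsilon> :: real
    assume F: "finite F" "F \<subseteq> verts G" "\<epsilon> > 0"
    then obtain g0 where g0: "finite {v \<in> verts ?H. g0 v \<noteq> 0}"
        "\<And>v. v \<in> F \<inter> verts ?H \<Longrightarrow> \<bar>g0 v - (f v - c)\<bar> \<le> \<epsilon>"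
        "finite_energy ?H r g0" "energy ?H r g0 \<le> K"
      using K[rule_format, of "F \<inter> verts ?H" \<epsilon>] by auto
    \<comment> \<open>Vertices lost in \<open>?H\<close> have no edges outside \<open>S\<close>, so
      their values are free: the exact target on \<open>F\<close>, and 0 elsewhere to keep the
      support finite.\<close>
    define g1 where "g1 v = (if v \<in> verts ?H then g0 v else if v \<in> F then f v - c else 0)" for v
    define g where "g v = truncate_at N (g1 v)" for v
    have "g v = 0" if "g1 v = 0" for v
      using that \<open>N \<ge> 0\<close> by (simp add: g_def truncate_at_id)
    then have "{v \<in> verts G. g v \<noteq> 0} \<subseteq> {v \<in> verts ?H. g0 v \<noteq> 0} \<union> F"
      by (force simp: g1_def split: if_splits)
    then have supp: "finite {v \<in> verts G. g v \<noteq> 0}"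
      using g0(1) F by (meson finite_Un finite_subset)
    have near: "\<forall>v\<in>F. \<bar>g v - (f v - c)\<bar> \<le> \<epsilon>"
    proof
      fix v assume v: "v \<in> F"
      \<comment> \<open>Since \<open>N\<close> bounds \<open>f - c\<close>, truncation fixes the
        target value; being 1-Lipschitz, it does not worsen the approximation.\<close>
      have "\<bar>g v - (f v - c)\<bar> = \<bar>truncate_at N (g1 v) - truncate_at N (f v - c)\<bar>"
        using fN v F by (auto simp: g_def truncate_at_id)
      also have "\<dots> \<le> \<bar>g1 v - (f v - c)\<bar>" by (rule abs_truncate_at_diff_le)
      also have "\<dots> \<le> \<epsilon>" using g0(2)[of v] v F by (auto simp: g1_def)
      finally show "\<bar>g v - (f v - c)\<bar> \<le> \<epsilon>" .
    qed
    have le: "\<bar>grad ?H g e\<bar> \<le> \<bar>grad ?H g0 e\<bar>" if "e \<in> edges ?H" for e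
    proof -
      have "grad ?H g1 e = grad ?H g0 e"
        using H that by (intro grad_cong) (auto simp: network_def g1_def)
      then show ?thesis
        using abs_grad_truncate_at_le[of ?H N g1 e] by (simp add: g_def[abs_def])
    qed
    have gH: "finite_energy ?H r g" "energy ?H r g \<le> energy ?H r g0"
      using energy_contraction[OF H g0(3) le] by auto
    have gN: "\<bar>g v\<bar> \<le> N" for v using \<open>N \<ge> 0\<close> by (simp add: g_def abs_truncate_at_le)
    have gG: "finite_energy G r g"
      "energy G r g \<le> energy ?H r g + 4 * N\<^sup>2 * (\<Sum>\<^sub>\<infinity>e\<in>S. 1 / r e)"
      using energy_add_edges[OF G gN gH(1)] by auto
    with gH(2) g0(4) have "energy G r g \<le> K + 4 * N\<^sup>2 * (\<Sum>\<^sub>\<infinity>e\<in>S. 1 / r e)" by linarith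
    with supp near gG(1)
    show "\<exists>g. finite {v \<in> verts G. g v \<noteq> 0} \<and> (\<forall>v\<in>F. \<bar>g v - (f v - c)\<bar> \<le> \<epsilon>) \<and>
        finite_energy G r g \<and> energy G r g \<le> K + 4 * N\<^sup>2 * (\<Sum>\<^sub>\<infinity>e\<in>S. 1 / r e)" by blast
  qed
  then show "\<exists>c. weakly_null G r (\<lambda>v. f v - c)" ..
qed

theorem corollary1p2:
  fixes G :: "('v, 'e) multigraph" and r :: "'e \<Rightarrow> real" and S :: "'e set"
  assumes "network G r"
    and "connected_graph G"
    and "locally_finite_graph G"
    and "S \<subseteq> edges G"
    and "connected_graph (delete_edges G S)"
    and "(\<lambda>e. 1 / r e) summable_on S"
  shows "O_HD (delete_edges G S) r \<longleftrightarrow> O_HD G r"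
proof -
  \<comment> \<open>Stated for arbitrary \<open>H\<close> because it is applied to both
    \<open>G\<close> and \<open>G - S\<close>; this uses that both are connected.\<close>
  have "O_HD H r \<longleftrightarrow> asymptotically_constant H r"
    if "network H r" "connected_graph H" "locally_finite_graph H" for H :: "('v, 'e) multigraph"
    using that O_HD_if_asymptotically_constant asymptotically_constant_if_O_HD by blast
  moreover have "asymptotically_constant (delete_edges G S) r \<longleftrightarrow> asymptotically_constant G r"
    using assms asymptotically_constant_delete_edges asymptotically_constant_add_edges by blast
  ultimately show ?thesis
    using assms network_delete_edges locally_finite_delete_edges by blast
qed

end
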